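(* Let $M$ be an (ordered) resource algebra with composition $\cdot$, validity predicate $\mathcal{V}$ and unit $\varepsilon$, let $R : \Omega \to M$ be a random resource variable, and for each outcome $\rho \in \Omega$ let $\Phi(\rho)$ be a predicate on $M$. Suppose that for every $\rho \in \Omega$ and every $c \in M$, if $\mathcal{V}(R(\rho)\cdot c)$ then there exists $x' \in M$ with $\mathcal{V}(x' \cdot c)$ and $\Phi(\rho)(x')$. Then for every probabilistic context $C$ (over $\mathrm{PSpAuth}(M)$), if $\mathcal{V}(C[(\varepsilon, R, \mathrm{None})])$ holds, there exists $R' : \Omega \to M$ such that $\mathcal{V}(C[(\varepsilon, R', \mathrm{None})])$ holds and $\Phi(\rho)(R'(\rho))$ holds for all $\rho \in \Omega$.
   Context: Fix a countable set $\mathrm{Rid}$ of randomness identifiers and the outcome space $\Omega = \mathrm{Rid} \to \mathrm{Bool}$. For a probability space $\psi = (\mathcal{F}, \mu)$ over $\Omega$ its support is $\mathrm{supp}(\psi) = \Omega \setminus \{\rho \mid \exists E \in \mathcal{F}.\ \rho \in E \wedge \mu(E) = 0\}$; the extension order is $(\mathcal{F}_1,\mu_1) \sqsubseteq (\mathcal{F}_2,\mu_2)$ iff $\mathcal{F}_1 \subseteq \mathcal{F}_2$ and $\mu_2|_{\mathcal{F}_1} = \mu_1$. The independent product $\psi_1 \circledast \psi_2$ of $(\mathcal{F}_1,\mu_1),(\mathcal{F}_2,\mu_2)$ is the (unique, if it exists) probability space on the $\sigma$-algebra generated by $\mathcal{F}_1 \cup \mathcal{F}_2$ with $\mu(E_1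 \cap E_2) = \mu_1(E_1)\mu_2(E_2)$ for $E_i \in \mathcal{F}_i$. $\mathrm{PSpRA}$ is the ordered resource algebra whose elements are complete probability spaces over $\Omega$ together with an invalid element $\bot$; valid means $\neq \bot$; composition is the independent product (giving $\bot$ if it does not exist); the unit is the trivial space $(\{\emptyset,\Omega\}, \cdot)$; the order is the extension order. $\mathrm{PSpAuth}(M) = \mathrm{PSpRA} \times (\Omega \to M) \times \mathrm{option}(\mathrm{PSpRA})$, with componentwise composition $(\psi,R,a)\cdot(\psi',R',a') = (\psi \circledast \psi', \lambda\rho.\,R(\rho)\cdot R'(\rho), a \oplus a')$ where $\mathrm{Some}\,a \oplus \mathrm{None} = \mathrm{None}\oplus \mathrm{Some}\,a = \mathrm{Some}\,a$, $\mathrm{None}\oplus\mathrm{None}=\mathrm{None}$ and $\mathrm{Some}\,a \oplus \mathrm{Some}\,b$ is invalid; validity $\mathcal{V}(\psi,R,a)$ holds iff $\psi \neq \bot$, $\mathcal{V}(R(\rho))$ for all $\rho$, and if $a = \mathrm{Some}\,\psi_a$ then $\psi_a \neq \bot$ and $\psi \sqsubseteq \psi_a$; the unit is $(\text{trivial space}, \lambda\rho.\varepsilon, \mathrm{None})$. Weighted sum on $\mathrm{PSpRA}$: for a finitely supported distribution $\mu$ on a set $A$ and $\kappa : A \to \mathrm{PSpRA}$, $\mathrm{wsum}(\mu,\kappa)$ is defined (otherwise $\bot$) when all $\kappa(a)$, $a \in \mathrm{supp}\,\mu$, are valid and $\mathrm{supp}(\kappa(a)) \cap \mathrm{supp}(\kappa(b))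 = \emptyset$ for distinct $a,b \in \mathrm{supp}\,\mu$; it is then the space whose $\sigma$-algebra is $\bigcap_{a \in \mathrm{supp}\,\mu} \mathcal{F}_{\kappa(a)}$ with measure $E \mapsto \sum_{a \in \mathrm{supp}\,\mu} \mu(a)\,\kappa(a)(E)$. Weighted sum on $\mathrm{PSpAuth}(M)$: for $\kappa : A \to \mathrm{PSpAuth}(M)$, $\mathrm{wsum}(\mu,\kappa) = (\psi, R, a)$ where $\psi$ is the $\mathrm{PSpRA}$ weighted sum of the first components; $R(\rho) = R_{\kappa(i)}(\rho)$ for the unique $i \in \mathrm{supp}\,\mu$ with $\rho$ in the support of the first component of $\kappa(i)$ if $\rho \in \mathrm{supp}(\psi)$, and $R(\rho) = \varepsilon$ otherwise; $a = \mathrm{None}$ if all authoritative components of $\kappa(i)$ are $\mathrm{None}$, and $a = \mathrm{Some}$ of the $\mathrm{PSpRA}$ weighted sum of the authoritative components if they are all $\mathrm{Some}$ (the paper defines the authoritative part only in these two cases). Probabilistic contexts are generated by $C ::= [\,] \mid c \cdot C \mid \mathrm{wsum}(\mu, \kappa[i \mapsto C])$ (with $c \in \mathrm{PSpAuth}(M)$, $\mu$ a finitely supported distribution on a set $A$, $\kappa : A \to \mathrm{PSpAuth}(M)$, $i \in A$), with filling $[\,][x] = x$, $(c\cdot C)[x] = c \cdot C[x]$, and $\mathrm{wsum}(\mu,\kappa[i\mapsto C])[x] = \mathrm{wsum}(\mu, \kappa[i \mapsto C[x]])$.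
   Formalization: The formal theorem additionally assumes that for every outcome ρ some x' in M satisfies Φ(ρ); otherwise the claim fails, since a weighted sum may discard an invalid R(ρ) outside its support while Φ(ρ) is empty. *)

theory Defs
  imports "HOL-Probability.Probability"
begin

section \<open>Ordered unital resource algebras\<close>

class ordered_resource_algebra = comm_monoid_mult + preorder +
  fixes valid :: "'a \<Rightarrow> bool"
  assumes valid_one: "valid 1"
    and valid_multD: "valid (a * b) \<Longrightarrow> valid a"
    and mult_mono_ora: "a \<le> b \<Longrightarrow> a * c \<le> b * c"
    and valid_antimono: "a \<le> b \<Longrightarrow> valid b \<Longrightarrow> valid a"


section \<open>Complete probability spaces over the outcome space\<close>

type_synonym 'r outcome = "'r \<Rightarrow> bool"

definition complete_psp :: "'r outcome measure \<Rightarrow> bool" where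
  "complete_psp N \<longleftrightarrow> prob_space N \<and> space N = UNIV \<and> complete_measure N"

definition trivial_measure :: "'a measure" where
  "trivial_measure = measure_of UNIV {{}, UNIV} (\<lambda>E. if E = {} then 0 else 1)"

lemma sets_trivial_measure: "sets (trivial_measure :: 'a measure) = {{}, UNIV}"
proof -
  have "sigma_algebra UNIV {{}, UNIV :: 'a set}"
    by (rule sigma_algebra_trivial)
  then show ?thesis
    unfolding trivial_measure_def
    by (simp add: sigma_algebra.sigma_sets_eq)
qed

lemma space_trivial_measure: "space (trivial_measure :: 'a measure) = UNIV"
  by (simp add: trivial_measure_def)

lemma emeasure_trivial_measure: "emeasure (trivial_measure :: 'a measure) UNIV = 1"
proof -
  let ?F = "{{}, UNIV :: 'a set}" and ?m = "\<lambda>E :: 'a set. if E = {} then 0 else 1 :: ennreal"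
  let ?M = "return (sigma UNIV {}) (undefined :: 'a)"
  have sets_M: "sets ?M = ?F"
    by (simp add: sigma_sets_empty_eq)
  have UNIV_M: "UNIV \<in> sets (sigma UNIV {} :: 'a measure)"
    by (simp add: sigma_sets_empty_eq)
  have eq: "emeasure ?M E = ?m E" if "E \<in> ?F" for E
  proof (cases "E = {}")
    case False
    then have "E = UNIV" using that by blast
    then show ?thesis by (simp only: emeasure_return[OF UNIV_M]) simp
  qed simp
  have "countably_additive ?F ?m"
    unfolding countably_additive_def
  proof (intro allI impI)
    fix A :: "nat \<Rightarrow> 'a set"
    assume A: "range A \<subseteq> ?F" "disjoint_family A" "\<Union>(range A) \<in> ?F"
    have "(\<Sum>i. emeasure ?M (A i)) = emeasure ?M (\<Union>(range A))"
      using A by (intro suminf_emeasure) (simp_all only: sets_M)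
    moreover have "(\<lambda>i. emeasure ?M (A i)) = (\<lambda>i. ?m (A i))"
      using A(1) by (intro ext eq) (rule subsetD, assumption, rule rangeI)
    ultimately show "(\<Sum>i. ?m (A i)) = ?m (\<Union>(range A))"
      by (simp only: eq[OF A(3)])
  qed
  then have "emeasure trivial_measure (UNIV :: 'a set) = ?m UNIV"
    unfolding trivial_measure_def
    by (intro emeasure_measure_of_sigma sigma_algebra_trivial) (simp_all add: positive_def)
  then show ?thesis by simp
qed

lemma complete_psp_trivial: "complete_psp trivial_measure"
  unfolding complete_psp_def
proof (intro conjI)
  show "prob_space (trivial_measure :: 'a outcome measure)"
    by (rule prob_spaceI) (simp only: emeasure_trivial_measure space_trivial_measure)
  show "complete_measure (trivial_measure :: 'a outcome measure)"
  proof
    fix A B :: "'a outcome set" assume "B \<subseteq> A" "A \<in> null_sets trivial_measure"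
    then have "A = {}"
      using emeasure_trivial_measure[where 'a = "'a outcome"]
      unfolding null_sets_def sets_trivial_measure by fastforce
    then show "B \<in> sets trivial_measure" using \<open>B \<subseteq> A\<close> by simp
  qed
qed (rule space_trivial_measure)

typedef 'r psp = "{N :: 'r outcome measure. complete_psp N}"
  morphisms measure_of_psp Abs_psp
  using complete_psp_trivial by blast

definition psp_supp :: "'r psp \<Rightarrow> 'r outcome set" where
  "psp_supp P =
     UNIV - {\<rho>. \<exists>E \<in> sets (measure_of_psp P). \<rho> \<in> E \<and> emeasure (measure_of_psp P) E = 0}"

definition psp_ext :: "'r psp \<Rightarrow> 'r psp \<Rightarrow> bool" where
  "psp_ext P Q \<longleftrightarrow>
     sets (measure_of_psp P) \<subseteq> sets (measure_of_psp Q) \<and>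
     (\<forall>E \<in> sets (measure_of_psp P). emeasure (measure_of_psp Q) E = emeasure (measure_of_psp P) E)"

definition is_indep_product ::
  "'r outcome measure \<Rightarrow> 'r outcome measure \<Rightarrow> 'r outcome measure \<Rightarrow> bool" where
  "is_indep_product N1 N2 N \<longleftrightarrow>
     prob_space N \<and> space N = UNIV \<and> sets N = sigma_sets UNIV (sets N1 \<union> sets N2) \<and>
     (\<forall>E1 \<in> sets N1. \<forall>E2 \<in> sets N2. emeasure N (E1 \<inter> E2) = emeasure N1 E1 * emeasure N2 E2)"

lemma is_indep_product_unique:
  assumes N1: "space N1 = UNIV" and N2: "space N2 = UNIV"
    and N: "is_indep_product N1 N2 N" and N': "is_indep_product N1 N2 N'"
  shows "N = N'"
proof -
  let ?E = "{E1 \<inter> E2 | E1 E2. E1 \<in> sets N1 \<and> E2 \<in> sets N2}"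
  have top: "UNIV \<in> sets N1" "UNIV \<in> sets N2"
    using sets.top[of N1] sets.top[of N2] N1 N2 by auto
  have gen: "sigma_sets UNIV (sets N1 \<union> sets N2) = sigma_sets UNIV ?E"
  proof (rule sigma_sets_eqI)
    fix X assume "X \<in> sets N1 \<union> sets N2"
    then have "X \<in> ?E"
      using top by (metis (mono_tags, lifting) Int_UNIV_left Int_UNIV_right UnE mem_Collect_eq)
    then show "X \<in> sigma_sets UNIV ?E" by (rule sigma_sets.Basic)
  next
    fix X assume "X \<in> ?E"
    then obtain E1 E2 where X: "X = E1 \<inter> E2" "E1 \<in> sets N1" "E2 \<in> sets N2" by blast
    interpret sigma_algebra UNIV "sigma_sets UNIV (sets N1 \<union> sets N2)"
      by (rule sigma_algebra_sigma_sets) simp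
    show "X \<in> sigma_sets UNIV (sets N1 \<union> sets N2)"
      unfolding X(1) using X(2,3) by (intro Int) (auto intro: sigma_sets.Basic)
  qed
  show ?thesis
  proof (rule measure_eqI_generator_eq[where A = "\<lambda>_. UNIV" and E = ?E])
    show "Int_stable ?E"
    proof (rule Int_stableI)
      fix a b assume "a \<in> ?E" "b \<in> ?E"
      then obtain A1 A2 B1 B2 where
        *: "a = A1 \<inter> A2" "b = B1 \<inter> B2" "A1 \<in> sets N1" "A2 \<in> sets N2" "B1 \<in> sets N1" "B2 \<in> sets N2"
        by blast
      then have "a \<inter> b = (A1 \<inter> B1) \<inter> (A2 \<inter> B2)" by blast
      moreover have "A1 \<inter> B1 \<in> sets N1" "A2 \<inter> B2 \<in> sets N2" using * by auto
      ultimately show "a \<inter> b \<in> ?E" by blast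
    qed
    show "emeasure N X = emeasure N' X" if "X \<in> ?E" for X
      using that N N' by (auto simp: is_indep_product_def)
    show "range (\<lambda>_. UNIV) \<subseteq> ?E" using top by blast
    show "emeasure N UNIV \<noteq> \<infinity>"
      using N prob_space.emeasure_space_1[of N] by (simp add: is_indep_product_def)
  qed (use N N' gen in \<open>auto simp: is_indep_product_def\<close>)
qed


section \<open>The resource algebra PSpRA\<close>

datatype 'r psp_ra = PSp "'r psp" | PBot

definition psp_one :: "'r psp_ra" where
  "psp_one = PSp (Abs_psp trivial_measure)"

definition psp_valid :: "'r psp_ra \<Rightarrow> bool" where
  "psp_valid \<psi> \<longleftrightarrow> \<psi> \<noteq> PBot"

text \<open>As usual for an invalid element, \<^const>\<open>PBot\<close> is the top of the order.\<close>

fun psp_le :: "'r psp_ra \<Rightarrow> 'r psp_ra \<Rightarrow> bool" where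
  "psp_le (PSp P) (PSp Q) = psp_ext P Q"
| "psp_le \<psi> PBot = True"
| "psp_le PBot (PSp Q) = False"

text \<open>
  The \<open>\<sigma>\<close>-algebra generated by two complete \<open>\<sigma>\<close>-algebras need not be complete, whereas the elements
  of PSpRA are complete spaces; the independent product is therefore completed.  The completion
  changes nothing when the generated space is complete already, and the product is invalid exactly
  when no independent product exists.
\<close>

fun psp_prod :: "'r psp_ra \<Rightarrow> 'r psp_ra \<Rightarrow> 'r psp_ra" where
  "psp_prod (PSp P) (PSp Q) =
     (if \<exists>N. is_indep_product (measure_of_psp P) (measure_of_psp Q) N
      then PSp (Abs_psp (completion (THE N. is_indep_product (measure_of_psp P) (measure_of_psp Q) N)))
      else PBot)"
| "psp_prod PBot \<psi> = PBot"
| "psp_prod \<psi> PBot = PBot"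

lemma complete_psp_completion:
  assumes "prob_space N" "space N = UNIV"
  shows "complete_psp (completion N)"
  unfolding complete_psp_def
  using assms prob_space.prob_space_completion completion.complete_measure_axioms by auto

fun psp_ra_supp :: "'r psp_ra \<Rightarrow> 'r outcome set" where
  "psp_ra_supp (PSp P) = psp_supp P"
| "psp_ra_supp PBot = {}"

fun psp_ra_measure :: "'r psp_ra \<Rightarrow> 'r outcome measure" where
  "psp_ra_measure (PSp P) = measure_of_psp P"
| "psp_ra_measure PBot = undefined"

definition wsum_measure :: "'a pmf \<Rightarrow> ('a \<Rightarrow> 'r outcome measure) \<Rightarrow> 'r outcome measure" where
  "wsum_measure \<mu> N =
     measure_of UNIV (\<Inter>a \<in> set_pmf \<mu>. sets (N a))
       (\<lambda>E. \<Sum>a \<in> set_pmf \<mu>. ennreal (pmf \<mu> a) * emeasure (N a) E)"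

definition psp_wsum :: "'a pmf \<Rightarrow> ('a \<Rightarrow> 'r psp_ra) \<Rightarrow> 'r psp_ra" where
  "psp_wsum \<mu> \<kappa> =
     (if (\<forall>a \<in> set_pmf \<mu>. psp_valid (\<kappa> a)) \<and>
         (\<forall>a \<in> set_pmf \<mu>. \<forall>b \<in> set_pmf \<mu>. a \<noteq> b \<longrightarrow> psp_ra_supp (\<kappa> a) \<inter> psp_ra_supp (\<kappa> b) = {})
      then PSp (Abs_psp (wsum_measure \<mu> (\<lambda>a. psp_ra_measure (\<kappa> a))))
      else PBot)"

lemma
  assumes fin: "finite (set_pmf \<mu>)" and N: "\<And>a. a \<in> set_pmf \<mu> \<Longrightarrow> complete_psp (N a)"
  shows sets_wsum_measure: "sets (wsum_measure \<mu> N) = (\<Inter>a \<in> set_pmf \<mu>. sets (N a))"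
    and emeasure_wsum_measure: "E \<in> sets (wsum_measure \<mu> N) \<Longrightarrow>
      emeasure (wsum_measure \<mu> N) E = (\<Sum>a \<in> set_pmf \<mu>. ennreal (pmf \<mu> a) * emeasure (N a) E)"
    and complete_psp_wsum_measure: "complete_psp (wsum_measure \<mu> N)"
proof -
  let ?F = "\<Inter>a \<in> set_pmf \<mu>. sets (N a)"
  let ?m = "\<lambda>E. \<Sum>a \<in> set_pmf \<mu>. ennreal (pmf \<mu> a) * emeasure (N a) E"
  have sp: "space (N a) = UNIV" "prob_space (N a)" "complete_measure (N a)" if "a \<in> set_pmf \<mu>" for a
    using N[OF that] by (auto simp: complete_psp_def)
  have sa: "sigma_algebra UNIV ?F"
    unfolding sigma_algebra_iff2
  proof (intro conjI ballI allI impI)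
    show "{} \<in> ?F" by auto
    show "UNIV - s \<in> ?F" if "s \<in> ?F" for s
    proof
      show "UNIV - s \<in> sets (N a)" if "a \<in> set_pmf \<mu>" for a
        using sets.compl_sets[of s "N a"] sp(1)[OF that] that \<open>s \<in> ?F\<close> by auto
    qed
    show "\<Union>(range A) \<in> ?F" if "range A \<subseteq> ?F" for A :: "nat \<Rightarrow> _"
      using that by (auto intro!: sets.countable_nat_UN)
  qed simp
  have ca: "countably_additive ?F ?m"
  proof (rule countably_additiveI)
    fix A :: "nat \<Rightarrow> _"
    assume A: "range A \<subseteq> ?F" "disjoint_family A"
    have "(\<Sum>i. ?m (A i)) = (\<Sum>a \<in> set_pmf \<mu>. \<Sum>i. ennreal (pmf \<mu> a) * emeasure (N a) (A i))"
      by (rule suminf_sum) simp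
    also have "\<dots> = (\<Sum>a \<in> set_pmf \<mu>. ennreal (pmf \<mu> a) * emeasure (N a) (\<Union>i. A i))"
    proof (rule sum.cong[OF refl])
      fix a assume "a \<in> set_pmf \<mu>"
      then have "range A \<subseteq> sets (N a)" using A(1) by blast
      then show "(\<Sum>i. ennreal (pmf \<mu> a) * emeasure (N a) (A i)) =
          ennreal (pmf \<mu> a) * emeasure (N a) (\<Union>i. A i)"
        using suminf_emeasure[OF _ A(2)] by (simp add: ennreal_suminf_cmult)
    qed
    finally show "(\<Sum>i. ?m (A i)) = ?m (\<Union>(range A))" .
  qed
  show s: "sets (wsum_measure \<mu> N) = ?F"
    unfolding wsum_measure_def
    by (subst sets_measure_of) (auto simp: sigma_algebra.sigma_sets_eq[OF sa])
  have em: "emeasure (wsum_measure \<mu> N) E = ?m E" if "E \<in> ?F" for E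
    unfolding wsum_measure_def
    by (rule emeasure_measure_of_sigma[OF sa _ ca that]) (simp add: positive_def)
  then show "E \<in> sets (wsum_measure \<mu> N) \<Longrightarrow> emeasure (wsum_measure \<mu> N) E = ?m E"
    using s by simp
  have u: "UNIV \<in> ?F"
  proof
    show "UNIV \<in> sets (N a)" if "a \<in> set_pmf \<mu>" for a
      using sets.top[of "N a"] sp(1)[OF that] by simp
  qed
  have spw: "space (wsum_measure \<mu> N) = UNIV" by (simp add: wsum_measure_def)
  have "emeasure (wsum_measure \<mu> N) UNIV = (\<Sum>a \<in> set_pmf \<mu>. ennreal (pmf \<mu> a))"
    unfolding em[OF u]
  proof (rule sum.cong[OF refl])
    show "ennreal (pmf \<mu> a) * emeasure (N a) UNIV = ennreal (pmf \<mu> a)" if "a \<in> set_pmf \<mu>" for a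
      using prob_space.emeasure_space_1[OF sp(2)[OF that]] sp(1)[OF that] by simp
  qed
  also have "\<dots> = 1"
    using sum_pmf_eq_1[OF fin order_refl] by (simp add: sum_ennreal)
  finally have "prob_space (wsum_measure \<mu> N)"
    by (intro prob_spaceI) (simp add: spw)
  moreover have "complete_measure (wsum_measure \<mu> N)"
  proof
    fix A B assume "B \<subseteq> A" and A: "A \<in> null_sets (wsum_measure \<mu> N)"
    then have "A \<in> ?F" "?m A = 0" using s em by (auto simp: null_sets_def)
    have "A \<in> null_sets (N a)" if "a \<in> set_pmf \<mu>" for a
      using that \<open>?m A = 0\<close> \<open>A \<in> ?F\<close> fin pmf_positive[OF that]
      by (auto simp: null_sets_def sum_eq_0_iff)
    then show "B \<in> sets (wsum_measure \<mu> N)"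
      unfolding s using complete_measure.complete[OF sp(3) \<open>B \<subseteq> A\<close>] by blast
  qed
  ultimately show "complete_psp (wsum_measure \<mu> N)"
    by (simp add: complete_psp_def spw)
qed


section \<open>The resource algebra PSpAuth\<close>

type_synonym ('r, 'm) psp_auth = "'r psp_ra \<times> ('r outcome \<Rightarrow> 'm) \<times> 'r psp_ra option"

text \<open>\<^term>\<open>Some PBot\<close> plays the role of the invalid authoritative component.\<close>

fun auth_opt :: "'r psp_ra option \<Rightarrow> 'r psp_ra option \<Rightarrow> 'r psp_ra option" where
  "auth_opt None b = b"
| "auth_opt a None = a"
| "auth_opt (Some _) (Some _) = Some PBot"

fun auth_mult ::
  "('r, 'm::ordered_resource_algebra) psp_auth \<Rightarrow> ('r, 'm) psp_auth \<Rightarrow> ('r, 'm) psp_auth" where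
  "auth_mult (\<psi>, R, a) (\<psi>', R', a') = (psp_prod \<psi> \<psi>', (\<lambda>\<rho>. R \<rho> * R' \<rho>), auth_opt a a')"

fun auth_valid :: "('r, 'm::ordered_resource_algebra) psp_auth \<Rightarrow> bool" where
  "auth_valid (\<psi>, R, a) \<longleftrightarrow>
     psp_valid \<psi> \<and> (\<forall>\<rho>. valid (R \<rho>)) \<and> (\<forall>\<psi>\<^sub>a. a = Some \<psi>\<^sub>a \<longrightarrow> psp_valid \<psi>\<^sub>a \<and> psp_le \<psi> \<psi>\<^sub>a)"

text \<open>
  The weighted sum is not specified when the authoritative components of the summands are neither
  all \<^const>\<open>None\<close> nor all \<^const>\<open>Some\<close>; as for an undefined weighted sum of spaces, the
  result is then taken to be invalid.
\<close>

definition auth_wsum ::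
  "'a pmf \<Rightarrow> ('a \<Rightarrow> ('r, 'm::ordered_resource_algebra) psp_auth) \<Rightarrow> ('r, 'm) psp_auth" where
  "auth_wsum \<mu> \<kappa> =
     (let \<psi>\<^sub>i = (\<lambda>i. fst (\<kappa> i)); R\<^sub>i = (\<lambda>i. fst (snd (\<kappa> i))); a\<^sub>i = (\<lambda>i. snd (snd (\<kappa> i)));
          \<psi> = psp_wsum \<mu> \<psi>\<^sub>i
      in (\<psi>,
          (\<lambda>\<rho>. if \<rho> \<in> psp_ra_supp \<psi>
                then R\<^sub>i (THE i. i \<in> set_pmf \<mu> \<and> \<rho> \<in> psp_ra_supp (\<psi>\<^sub>i i)) \<rho>
                else 1),
          if \<forall>i \<in> set_pmf \<mu>. a\<^sub>i i = None then None
          else if \<forall>i \<in> set_pmf \<mu>. a\<^sub>i i \<noteq> None then Some (psp_wsum \<mu> (\<lambda>i. the (a\<^sub>i i)))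
          else Some PBot))"


section \<open>Probabilistic contexts\<close>

text \<open>
  The index sets of the weighted sums are rendered by the type variable \<^typ>\<open>'a\<close>.  This loses
  no generality: a weighted sum only depends on the values of \<open>\<kappa>\<close> on the support of \<open>\<mu>\<close>, so the
  finitely many index sets occurring in a context can be embedded into a common type.
\<close>

datatype ('r, 'm, 'a) prob_ctx =
    Hole
  | Mult "('r, 'm) psp_auth" "('r, 'm, 'a) prob_ctx"
  | WSum "'a pmf" "'a \<Rightarrow> ('r, 'm) psp_auth" 'a "('r, 'm, 'a) prob_ctx"

primrec finitely_supported :: "('r, 'm, 'a) prob_ctx \<Rightarrow> bool" where
  "finitely_supported Hole \<longleftrightarrow> True"
| "finitely_supported (Mult c C) \<longleftrightarrow> finitely_supported C"
| "finitely_supported (WSum \<mu> \<kappa> i C) \<longleftrightarrow> finite (set_pmf \<mu>) \<and> finitely_supported C"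

primrec fill ::
  "('r, 'm::ordered_resource_algebra, 'a) prob_ctx \<Rightarrow> ('r, 'm) psp_auth \<Rightarrow> ('r, 'm) psp_auth" where
  "fill Hole x = x"
| "fill (Mult c C) x = auth_mult c (fill C x)"
| "fill (WSum \<mu> \<kappa> i C) x = auth_wsum \<mu> (\<kappa>(i := fill C x))"

text \<open>
  Pitfall: a weighted sum discards the random resource of the filled hole outside the support of
  the hole's summand, and everywhere if the hole's index is not in the support of \<open>\<mu>\<close>.  Validity
  of the filled context therefore says nothing about \<open>R \<rho>\<close> at such outcomes \<open>\<rho>\<close>: if \<open>R \<rho>\<close> is
  invalid there, a frame-preserving update of \<open>R \<rho>\<close> to \<open>\<Phi> \<rho>\<close> holds vacuously even for an empty
  predicate \<open>\<Phi> \<rho>\<close>.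
\<close>

end

(* Filling a context changes the random resource pointwise: the spaces do not depend on the resource
   in the hole, hence neither do the summands that a weighted sum selects. At each outcome the filled
   context therefore either discards the resource R of the hole or multiplies R by a frame c, and in
   the latter case the frame-preserving update of R applies to the frame c. *)
theory Submission
  imports Defs
begin

definition frame_or_const :: "('m::ordered_resource_algebra \<Rightarrow> 'm) \<Rightarrow> bool" where
  "frame_or_const f \<longleftrightarrow> (\<exists>c. f = (\<lambda>x. x * c)) \<or> (\<exists>c. f = (\<lambda>x. c))"

lemma frame_or_const_id: "frame_or_const (\<lambda>x. x)"
  unfolding frame_or_const_def by (rule disjI1, rule exI[of _ 1]) simp

lemma frame_or_const_const: "frame_or_const (\<lambda>x. c)"
  unfolding frame_or_const_def by blast

text \<open>By commutativity an outer factor \<open>c\<close> is absorbed into the frame, and a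
  constant stays constant.\<close>

lemma frame_or_const_mult:
  assumes "frame_or_const f"
  shows "frame_or_const (\<lambda>x. c * f x)"
  using assms unfolding frame_or_const_def
proof (elim disjE exE)
  fix d assume "f = (\<lambda>x. x * d)"
  then have "(\<lambda>x. c * f x) = (\<lambda>x. x * (c * d))" by (simp add: mult.left_commute)
  then show "(\<exists>e. (\<lambda>x. c * f x) = (\<lambda>x. x * e)) \<or> (\<exists>e. (\<lambda>x. c * f x) = (\<lambda>x. e))" by blast
qed auto

text \<open>For a frame, \<open>update\<close> applies directly. For a constant \<open>f\<close>,
  validity of \<open>f r\<close> gives no information about \<open>r\<close>, so
  \<open>inhabited\<close> supplies the witness; \<open>f\<close> takes the same valid value
  there.\<close>

lemma frame_or_const_update:
  assumes f: "frame_or_const f" and valid: "valid (f r)"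
    and update: "\<And>c. valid (r * c) \<Longrightarrow> \<exists>x'. valid (x' * c) \<and> P x'"
    and inhabited: "\<exists>x'. P x'"
  shows "\<exists>x'. valid (f x') \<and> P x'"
  using f valid update inhabited unfolding frame_or_const_def by auto

text \<open>The order of quantifiers matters: \<open>\<psi>'\<close>, \<open>f\<close> and
  \<open>a'\<close> are chosen before \<open>R\<close>, so one triple describes the filling for the
  old and for the updated resource.\<close>

lemma fill_pointwise:
  fixes C :: "('r, 'm::ordered_resource_algebra, 'a) prob_ctx"
  shows "\<exists>\<psi>' f a'. (\<forall>\<rho>. frame_or_const (f \<rho>)) \<and>
    (\<forall>R. fill C (\<psi>, R, a) = (\<psi>', \<lambda>\<rho>. f \<rho> (R \<rho>), a'))"
proof (induction C)
  case Hole
  show ?case by (rule exI[of _ \<psi>], rule exI[of _ "\<lambda>\<rho> x. x"]) (simp add: frame_or_const_id)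
next
  case (Mult c C)
  obtain \<psi>' f a' where f: "\<And>\<rho>. frame_or_const (f \<rho>)"
    and fill: "\<And>R. fill C (\<psi>, R, a) = (\<psi>', \<lambda>\<rho>. f \<rho> (R \<rho>), a')"
    using Mult.IH by blast
  obtain \<psi>c Rc ac where c: "c = (\<psi>c, Rc, ac)" by (cases c)
  show ?case
    by (rule exI[of _ "psp_prod \<psi>c \<psi>'"], rule exI[of _ "\<lambda>\<rho> x. Rc \<rho> * f \<rho> x"],
        rule exI[of _ "auth_opt ac a'"])
      (simp add: c fill f frame_or_const_mult)
next
  case (WSum \<mu> \<kappa> i C)
  obtain \<psi>' f a' where f: "\<And>\<rho>. frame_or_const (f \<rho>)"
    and fill: "\<And>R. fill C (\<psi>, R, a) = (\<psi>', \<lambda>\<rho>. f \<rho> (R \<rho>), a')"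
    using WSum.IH by blast
  define \<psi>s where "\<psi>s j = (if j = i then \<psi>' else fst (\<kappa> j))" for j
  define as where "as j = (if j = i then a' else snd (snd (\<kappa> j)))" for j
  \<comment> \<open>The index whose resource the weighted sum reads at \<open>\<rho>\<close>. It is
    computed from the spaces alone, hence is independent of \<open>R\<close>. Whichever index
    \<open>THE\<close> yields, either it is \<open>i\<close> and \<open>f \<rho>\<close> acts, or
    the result is constant in the resource of the hole.\<close>
  define sel where "sel \<rho> = (THE j. j \<in> set_pmf \<mu> \<and> \<rho> \<in> psp_ra_supp (\<psi>s j))" for \<rho>
  define g where "g \<rho> x = (if \<rho> \<in> psp_ra_supp (psp_wsum \<mu> \<psi>s)
    then if sel \<rho> = i then f \<rho> x else fst (snd (\<kappa> (sel \<rho>))) \<rho> else 1)" for \<rho> x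
  define b where "b = (if \<forall>j \<in> set_pmf \<mu>. as j = None then None
    else if \<forall>j \<in> set_pmf \<mu>. as j \<noteq> None then Some (psp_wsum \<mu> (\<lambda>j. the (as j))) else Some PBot)"
  have "frame_or_const (g \<rho>)" for \<rho>
    by (cases "\<rho> \<in> psp_ra_supp (psp_wsum \<mu> \<psi>s)"; cases "sel \<rho> = i")
      (simp_all add: g_def[abs_def] f frame_or_const_const)
  moreover have "fill (WSum \<mu> \<kappa> i C) (\<psi>, R, a) = (psp_wsum \<mu> \<psi>s, \<lambda>\<rho>. g \<rho> (R \<rho>), b)" for R
  proof -
    let ?\<kappa> = "\<kappa>(i := fill C (\<psi>, R, a))"
    \<comment> \<open>The weighted sum uses the updated family only through its three projections,
      and \<open>R\<close> enters only the middle one, at index \<open>i\<close>.\<close>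
    have \<psi>s: "(\<lambda>j. fst (?\<kappa> j)) = \<psi>s" and as: "(\<lambda>j. snd (snd (?\<kappa> j))) = as"
      and Rs: "fst (snd (?\<kappa> j)) \<rho> = (if j = i then f \<rho> (R \<rho>) else fst (snd (\<kappa> j)) \<rho>)" for j \<rho>
      by (auto simp: \<psi>s_def as_def fill)
    show ?thesis
      unfolding fill.simps auth_wsum_def Let_def \<psi>s fun_cong[OF \<psi>s] fun_cong[OF as] Rs
        g_def sel_def b_def
      by (rule refl)
  qed
  ultimately show ?case by blast
qed

theorem mainTheorem1:
  fixes R :: "('r::countable) outcome \<Rightarrow> 'm::ordered_resource_algebra"
    and \<Phi> :: "'r outcome \<Rightarrow> 'm \<Rightarrow> bool"
    and C :: "('r, 'm, 'a) prob_ctx"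
  assumes update: "\<And>\<rho> c. valid (R \<rho> * c) \<Longrightarrow> \<exists>x'. valid (x' * c) \<and> \<Phi> \<rho> x'"
    and inhabited: "\<And>\<rho>. \<exists>x'. \<Phi> \<rho> x'"
    and prob_context: "finitely_supported C"
    and valid_fill: "auth_valid (fill C (psp_one, R, None))"
  shows "\<exists>R'. auth_valid (fill C (psp_one, R', None)) \<and> (\<forall>\<rho>. \<Phi> \<rho> (R' \<rho>))"
proof -
  obtain \<psi> f a where f: "\<And>\<rho>. frame_or_const (f \<rho>)"
    and fill: "\<And>R. fill C (psp_one, R, None) = (\<psi>, \<lambda>\<rho>. f \<rho> (R \<rho>), a)"
    using fill_pointwise[of C psp_one None] by blast
  have "valid (f \<rho> (R \<rho>))" for \<rho>
    using valid_fill by (simp add: fill)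
  then have "\<exists>x'. valid (f \<rho> x') \<and> \<Phi> \<rho> x'" for \<rho>
    using frame_or_const_update[OF f _ update inhabited] by blast
  \<comment> \<open>Choice over the outcomes assembles the pointwise witnesses into one
    function.\<close>
  then obtain R' where "\<And>\<rho>. valid (f \<rho> (R' \<rho>)) \<and> \<Phi> \<rho> (R' \<rho>)" by metis
  then show ?thesis
    \<comment> \<open>The space \<open>\<psi>\<close> and the authoritative part \<open>a\<close>
      are those obtained for \<open>R\<close>, so their validity conditions carry over.\<close>
    using valid_fill by (intro exI[of _ R']) (simp add: fill)
qed

end
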